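(* Consider a symmetric indeterminate Hamburger moment problem (i.e. $a_n=0$ for all $n\ge 0$, with $b_n>0$), and put $$v_n=P_{2n}^2(0),\qquad u_n=Q_{2n-1}^2(0),\qquad n\ge 1.$$ Assume that (i) $(u_n)\in\ell^{\alpha}$ and $(v_n)\in\ell^{\beta}$, where $0<\alpha,\beta\le 1$. Assume also that there exist constants $C,D>0$ such that (ii) $u_n\le C v_n^{\beta/\alpha}$ for all $n\ge 1$; (iii) $v_j\le D v_i$ for all $1\le i\le j$. Let $\gamma$ be the harmonic mean of $\alpha$ and $\beta$, i.e. $\gamma^{-1}=\frac12\left(\alpha^{-1}+\beta^{-1}\right)$. Then the order $\rho$ of the moment problem satisfies $\rho\le\gamma$.
   Context: A (normalized) Hamburger moment problem is described by its Jacobi parameters $(a_n)_{n\ge0}$ (real) and $(b_n)_{n\ge0}$ (positive). The orthonormal polynomials $P_n$ and the polynomials of the second kind $Q_n$ both satisfy $z r_n(z)=b_nr_{n+1}(z)+a_nr_n(z)+b_{n-1}r_{n-1}(z)$ for $n\ge0$, with the convention $b_{-1}:=1$ and initial conditions $P_{-1}=0$, $P_0=1$, $Q_{-1}=-1$, $Q_0=0$. The problem is symmetric if $a_n=0$ for all $n$. It is indeterminate if and only if $\sum_{n=0}^\infty (P_n^2(0)+Q_n^2(0))<\infty$. In that case the following series define entire functions (the entries of the Nevanlinna matrix): $$A(z)=z\sum_{k\ge0}Q_k(0)Q_k(z),\quad B(z)=-1+z\sum_{k\ge0}Q_k(0)P_k(z),$$ $$C(z)=1+z\sum_{k\ge0}P_k(0)Q_k(z),\quad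 D(z)=z\sum_{k\ge0}P_k(0)P_k(z).$$ It is known that these four functions have a common order $\rho\in[0,1]$, called the order of the moment problem. (The constants $C,D$ in the claim are unrelated to the functions $C(z),D(z)$.) The order of a non-constant entire function $f$ is $\rho_f=\limsup_{r\to\infty}\frac{\log\log \mathcal M_f(r)}{\log r}$, where $\mathcal M_f(r)=\max_{|z|=r}|f(z)|$. A complex sequence $(x_n)$ belongs to $\ell^{\alpha}$, $\alpha>0$, if $\sum|x_n|^{\alpha}<\infty$. *)

theory Defs
  imports "HOL-Analysis.Analysis"
begin

text \<open>
  Solutions of
  \<open>z r\<^sub>n(z) = b\<^sub>n r\<^sub>n\<^sub>+\<^sub>1(z) + a\<^sub>n r\<^sub>n(z) + b\<^sub>n\<^sub>-\<^sub>1 r\<^sub>n\<^sub>-\<^sub>1(z)\<close> for \<open>n \<ge> 0\<close>, with \<open>b\<^sub>-\<^sub>1 = 1\<close>.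
  The index is shifted by one: \<open>three_term a b x y k z\<close> is \<open>r\<^sub>k\<^sub>-\<^sub>1(z)\<close> for the
  solution with \<open>r\<^sub>-\<^sub>1 = x\<close> and \<open>r\<^sub>0 = y\<close>. The coefficients are real, and the argument
  may be real or complex.
\<close>

fun three_term ::
  "(nat \<Rightarrow> real) \<Rightarrow> (nat \<Rightarrow> real) \<Rightarrow> real \<Rightarrow> real \<Rightarrow> nat \<Rightarrow> 'a::real_normed_field \<Rightarrow> 'a" where
  "three_term a b x y 0 z = of_real x"
| "three_term a b x y (Suc 0) z = of_real y"
| "three_term a b x y (Suc (Suc n)) z =
     ((z - of_real (a n)) * three_term a b x y (Suc n) z
       - of_real (if n = 0 then 1 else b (n - 1)) * three_term a b x y n z) / of_real (b n)"

lemma three_term_recurrence: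
  assumes "b n > 0"
  shows "z * three_term a b x y (Suc n) z =
           of_real (b n) * three_term a b x y (Suc (Suc n)) z
             + of_real (a n) * three_term a b x y (Suc n) z
             + of_real (if n = 0 then 1 else b (n - 1)) * three_term a b x y n z"
proof -
  have "of_real (b n) * three_term a b x y (Suc (Suc n)) z =
          (z - of_real (a n)) * three_term a b x y (Suc n) z
            - of_real (if n = 0 then 1 else b (n - 1)) * three_term a b x y n z"
    using assms by simp
  then show ?thesis
    by (simp only: left_diff_distrib) simp
qed

definition orthoP :: "(nat \<Rightarrow> real) \<Rightarrow> (nat \<Rightarrow> real) \<Rightarrow> nat \<Rightarrow> 'a::real_normed_field \<Rightarrow> 'a" where
  "orthoP a b n z = three_term a b 0 1 (Suc n) z"

definition secondQ :: "(nat \<Rightarrow> real) \<Rightarrow> (nat \<Rightarrow> real) \<Rightarrow> nat \<Rightarrow> 'a::real_normed_field \<Rightarrow> 'a" where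
  "secondQ a b n z = three_term a b (- 1) 0 (Suc n) z"

definition hamburger_solutions :: "(nat \<Rightarrow> real) \<Rightarrow> real measure set" where
  "hamburger_solutions s =
     {M. sets M = sets borel \<and> (\<forall>n. integrable M (\<lambda>x. x ^ n) \<and> (\<integral>x. x ^ n \<partial>M) = s n)}"

definition indeterminate :: "(nat \<Rightarrow> real) \<Rightarrow> bool" where
  "indeterminate s \<longleftrightarrow>
     (\<exists>M N. M \<in> hamburger_solutions s \<and> N \<in> hamburger_solutions s \<and> M \<noteq> N)"

text \<open>
  The sequence \<open>s\<close> is a moment sequence whose orthonormal polynomials are those given by
  the Jacobi parameters \<open>a\<close> and \<open>b\<close>. Orthonormality depends only on the moments, so one
  solution \<open>M\<close> is as good as any other; since \<open>P\<^sub>0 = 1\<close>, it includes the normalization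
  \<open>s 0 = 1\<close>.
\<close>

definition jacobi_parameters :: "(nat \<Rightarrow> real) \<Rightarrow> (nat \<Rightarrow> real) \<Rightarrow> (nat \<Rightarrow> real) \<Rightarrow> bool" where
  "jacobi_parameters s a b \<longleftrightarrow>
     (\<forall>n. b n > 0) \<and>
     (\<exists>M \<in> hamburger_solutions s.
        \<forall>m n. (\<integral>x. orthoP a b m x * orthoP a b n x \<partial>M) = (if m = n then 1 else 0))"

definition nevanlinna_A :: "(nat \<Rightarrow> real) \<Rightarrow> (nat \<Rightarrow> real) \<Rightarrow> complex \<Rightarrow> complex" where
  "nevanlinna_A a b z = z * (\<Sum>k. secondQ a b k 0 * secondQ a b k z)"

definition nevanlinna_B :: "(nat \<Rightarrow> real) \<Rightarrow> (nat \<Rightarrow> real) \<Rightarrow> complex \<Rightarrow> complex" where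
  "nevanlinna_B a b z = - 1 + z * (\<Sum>k. secondQ a b k 0 * orthoP a b k z)"

definition nevanlinna_C :: "(nat \<Rightarrow> real) \<Rightarrow> (nat \<Rightarrow> real) \<Rightarrow> complex \<Rightarrow> complex" where
  "nevanlinna_C a b z = 1 + z * (\<Sum>k. orthoP a b k 0 * secondQ a b k z)"

definition nevanlinna_D :: "(nat \<Rightarrow> real) \<Rightarrow> (nat \<Rightarrow> real) \<Rightarrow> complex \<Rightarrow> complex" where
  "nevanlinna_D a b z = z * (\<Sum>k. orthoP a b k 0 * orthoP a b k z)"

definition max_modulus :: "(complex \<Rightarrow> complex) \<Rightarrow> real \<Rightarrow> real" where
  "max_modulus f r = (SUP z\<in>sphere 0 r. norm (f z))"

text \<open>
  Meant for non-constant entire \<open>f\<close>, where \<open>max_modulus f r\<close> tends to infinity, so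
  both logarithms are eventually taken of positive numbers.
\<close>

definition entire_order :: "(complex \<Rightarrow> complex) \<Rightarrow> ereal" where
  "entire_order f = Limsup at_top (\<lambda>r. ereal (ln (ln (max_modulus f r)) / ln r))"

definition in_ell :: "real \<Rightarrow> (nat \<Rightarrow> 'a::real_normed_vector) \<Rightarrow> bool" where
  "in_ell p x \<longleftrightarrow> summable (\<lambda>n. norm (x n) powr p)"

end

theory Submission imports Defs begin

text \<open>
  Write a solution of the recurrence at \<open>z\<close> as \<open>R\<^sub>n(z) = E\<^sub>n Q\<^sub>n(0) - F\<^sub>n P\<^sub>n(0)\<close>, varying the
  constants of a solution at \<open>0\<close>. The limits of the coefficients \<open>E\<^sub>n\<close>, \<open>F\<^sub>n\<close> are exactly
  \<open>D\<close>, \<open>B\<close> for \<open>R = P\<close>, and \<open>C\<close>, \<open>A\<close> for \<open>R = Q\<close> (lemma \<open>variation_of_constants\<close>). In a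
  symmetric problem \<open>P\<^sub>n(0) Q\<^sub>n(0) = 0\<close>, which reduces the update to
  \<open>E\<^sub>n\<^sub>+\<^sub>1 = E\<^sub>n - z P\<^sub>n(0)\<^sup>2 F\<^sub>n\<close> and \<open>F\<^sub>n\<^sub>+\<^sub>1 = F\<^sub>n + z Q\<^sub>n(0)\<^sup>2 E\<^sub>n\<close>.
  So \<open>|E\<^sub>n|\<close> and \<open>|F\<^sub>n|\<close> grow at most as in a linear recurrence whose off-diagonal entries
  are \<open>r g\<^sub>n\<close> and \<open>r f\<^sub>n\<close>, where \<open>r = |z|\<close>, \<open>g\<^sub>n = P\<^sub>n(0)\<^sup>2\<close> and \<open>f\<^sub>n = Q\<^sub>n(0)\<^sup>2\<close>.

  The heart of the proof is the bound \<open>exp (M r\<^sup>\<gamma>)\<close> for such a recurrence (lemma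
  \<open>coupled_growth_exp_powr\<close>). By (ii) and (iii) there are a decreasing sequence \<open>w\<close> with
  \<open>w \<in> \<ell>\<^sup>\<beta>\<close> and a constant \<open>K\<close> such that \<open>g \<le> K w\<close> and \<open>f \<le> K w\<^sup>\<sigma>\<close>, where
  \<open>\<sigma> = \<beta>/\<alpha>\<close>. In the weighted norm \<open>w\<^sub>n\<^sup>\<sigma>\<^sup>/\<^sup>2 |E\<^sub>n| + w\<^sub>n\<^sup>1\<^sup>/\<^sup>2 |F\<^sub>n|\<close> both
  off-diagonal entries become at most \<open>K r w\<^sub>n\<^sup>\<theta>\<close> with \<open>\<theta> = (1 + \<sigma>)/2 = \<beta>/\<gamma>\<close>, and
  \<open>1 + K r w\<^sup>\<theta> \<le> exp ((K/\<gamma>) r\<^sup>\<gamma> w\<^sup>\<beta>)\<close>, so the product of all factors is at most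
  \<open>exp (const r\<^sup>\<gamma>)\<close>. Passing from one weight to the next costs nothing, because the weights
  decrease. They tend to \<open>0\<close>, however, so a bound on the weighted norm says nothing uniform
  about \<open>E\<^sub>n\<close> and \<open>F\<^sub>n\<close>. The remedy is to freeze the weights once \<open>w\<^sub>n\<close> falls below the level
  \<open>\<delta>\<close> given by \<open>r \<delta>\<^sup>\<theta> = 1\<close>. Because \<open>\<alpha>, \<beta> \<le> 1\<close>, the off-diagonal entries are then at
  most \<open>K r w\<^sub>n\<^sup>\<beta> \<delta>\<^sup>\<theta>\<^sup>-\<^sup>\<beta>\<close>, and the factors satisfy the same exponential bound (lemma
  \<open>truncated_weight_factor\<close>), while removing the weights at the end costs only a factor \<open>r\<close>.

  The iterated logarithm in the definition of the order also calls for a lower bound on the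
  maximum modulus. It comes from the imaginary axis, where up to constant phases the recurrence
  has nonnegative entries, so that nothing cancels (lemma \<open>imaginary_axis_norms\<close>).
\<close>

section \<open>Coupled linear recurrences\<close>

text \<open>
  The weights \<open>p\<close>, \<open>q\<close> serve to balance two off-diagonal entries of different size. Since
  they decrease, replacing \<open>p n\<close> by \<open>p (Suc n)\<close> in the weighted norm costs no factor.
\<close>

lemma weighted_coupled_growth:
  fixes X Y g f p q h :: "nat \<Rightarrow> real" and r :: real
  assumes X0: "\<And>n. X n \<ge> 0" and Y0: "\<And>n. Y n \<ge> 0"
    and XS: "\<And>n. X (Suc n) \<le> X n + r * g n * Y n"
    and YS: "\<And>n. Y (Suc n) \<le> Y n + r * f n * X n"
    and p0: "\<And>n. p n \<ge> 0" and q0: "\<And>n. q n \<ge> 0"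
    and pS: "\<And>n. p (Suc n) \<le> p n" and qS: "\<And>n. q (Suc n) \<le> q n"
    and gp: "\<And>n. r * g n * p n \<le> h n * q n"
    and fq: "\<And>n. r * f n * q n \<le> h n * p n"
    and h0: "\<And>n. h n \<ge> 0"
  shows "p n * X n + q n * Y n \<le> (p 0 * X 0 + q 0 * Y 0) * (\<Prod>k<n. 1 + h k)"
proof (induction n)
  case 0
  then show ?case by simp
next
  case (Suc n)
  have "p (Suc n) * X (Suc n) \<le> p n * (X n + r * g n * Y n)"
    using pS[of n] XS[of n] p0 X0 by (intro mult_mono) auto
  also have "\<dots> = p n * X n + (r * g n * p n) * Y n"
    by (simp add: algebra_simps)
  also have "\<dots> \<le> p n * X n + (h n * q n) * Y n"
    using gp[of n] Y0[of n] by (intro add_left_mono mult_right_mono)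
  finally have 1: "p (Suc n) * X (Suc n) \<le> p n * X n + h n * q n * Y n" .
  have "q (Suc n) * Y (Suc n) \<le> q n * (Y n + r * f n * X n)"
    using qS[of n] YS[of n] q0 Y0 by (intro mult_mono) auto
  also have "\<dots> = q n * Y n + (r * f n * q n) * X n"
    by (simp add: algebra_simps)
  also have "\<dots> \<le> q n * Y n + (h n * p n) * X n"
    using fq[of n] X0[of n] by (intro add_left_mono mult_right_mono)
  finally have 2: "q (Suc n) * Y (Suc n) \<le> q n * Y n + h n * p n * X n" .
  have "p (Suc n) * X (Suc n) + q (Suc n) * Y (Suc n) \<le> (p n * X n + q n * Y n) * (1 + h n)"
    using 1 2 by (simp add: algebra_simps)
  also have "\<dots> \<le> (p 0 * X 0 + q 0 * Y 0) * (\<Prod>k<n. 1 + h k) * (1 + h n)"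
    using Suc h0[of n] by (intro mult_right_mono) auto
  finally show ?case by (simp add: mult.assoc)
qed

text \<open>
  For \<open>\<gamma> = 1\<close> this is \<open>1 + y \<le> exp y\<close>; the smaller power on the right is what lowers the order
  from \<open>1\<close> to \<open>\<gamma>\<close>. For large \<open>y\<close> the estimate \<open>ln t \<le> t - 1\<close> at \<open>t = y powr \<gamma>\<close> leaves a
  surplus \<open>exp (1 / \<gamma>) \<ge> 2\<close>, which absorbs the summand \<open>1\<close>.
\<close>

lemma one_plus_le_exp_powr:
  fixes y \<gamma> :: real
  assumes "y \<ge> 0" "0 < \<gamma>" "\<gamma> \<le> 1"
  shows "1 + y \<le> exp (y powr \<gamma> / \<gamma>)"
proof (cases "y \<le> 1")
  case True
  have "y \<le> y powr \<gamma>"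
    using assms True powr_mono'[of \<gamma> 1 y] by simp
  also have "\<dots> \<le> y powr \<gamma> / \<gamma>"
    using assms by (simp add: field_simps mult_left_le_one_le)
  finally show ?thesis
    using exp_ge_add_one_self[of y] by (meson exp_le_cancel_iff order_trans)
next
  case False
  have "ln y = ln (y powr \<gamma>) / \<gamma>"
    using False assms by (simp add: ln_powr)
  also have "\<dots> \<le> (y powr \<gamma> - 1) / \<gamma>"
    using False assms by (intro divide_right_mono ln_le_minus_one) auto
  finally have "ln y + 1 \<le> (y powr \<gamma> - 1) / \<gamma> + 1 / \<gamma>"
    using assms by (intro add_mono) (auto simp: field_simps)
  also have "\<dots> = y powr \<gamma> / \<gamma>"
    by (simp add: diff_divide_distrib)
  finally have "exp (ln y + 1) \<le> exp (y powr \<gamma> / \<gamma>)"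
    by simp
  moreover have "1 + y \<le> 2 * y"
    using False by simp
  moreover have "2 * y \<le> exp (ln y + 1)"
    using False exp_ge_add_one_self[of "1::real"] by (simp add: exp_add)
  ultimately show ?thesis by linarith
qed

text \<open>
  This trades the surplus of the exponent \<open>\<sigma>\<close> over \<open>\<beta>\<close> for a power of an upper bound \<open>W\<close>,
  and keeps \<open>w powr \<beta>\<close>, which is the part that can be summed.
\<close>

lemma powr_le_powr_mult_powr_diff:
  fixes w W :: real
  assumes "0 \<le> w" "w \<le> W" "\<beta> \<le> \<sigma>"
  shows "w powr \<sigma> \<le> w powr \<beta> * W powr (\<sigma> - \<beta>)"
proof -
  have "w powr \<sigma> = w powr \<beta> * w powr (\<sigma> - \<beta>)"
    by (simp flip: powr_add)
  also have "\<dots> \<le> w powr \<beta> * W powr (\<sigma> - \<beta>)"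
    using assms by (intro mult_left_mono powr_mono2) auto
  finally show ?thesis .
qed

text \<open>
  The level \<open>\<delta>\<close> solves \<open>r * \<delta> powr \<theta> = 1\<close>. Below it, \<open>r * \<delta> powr (\<theta> - \<beta>) = r powr \<gamma>\<close>,
  so the term added to \<open>1\<close> is already at most the exponent on the right. Above it, that term is
  \<open>K * r * w powr \<theta>\<close>, whose power with exponent \<open>\<gamma>\<close> is at most
  \<open>K * r powr \<gamma> * w powr \<beta>\<close>.
\<close>

lemma truncated_weight_factor:
  fixes w r \<beta> \<gamma> \<theta> K :: real
  assumes "0 \<le> w" "0 < r" "0 < \<gamma>" "\<gamma> \<le> 1" "0 < \<theta>" "\<theta> * \<gamma> = \<beta>" "1 \<le> K"
  defines "\<delta> \<equiv> r powr (- 1 / \<theta>)"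
  shows "1 + K * r * w powr \<beta> * max w \<delta> powr (\<theta> - \<beta>) \<le> exp (K / \<gamma> * r powr \<gamma> * w powr \<beta>)"
proof (cases "w \<le> \<delta>")
  case True
  have "r * \<delta> powr (\<theta> - \<beta>) = r powr (1 + (- 1 / \<theta>) * (\<theta> - \<beta>))"
    using assms unfolding \<delta>_def by (simp only: powr_powr powr_add) simp
  also have "1 + (- 1 / \<theta>) * (\<theta> - \<beta>) = \<gamma>"
    using assms by (simp add: field_simps)
  finally have "K * r * w powr \<beta> * max w \<delta> powr (\<theta> - \<beta>) = K * (r powr \<gamma> * w powr \<beta>)"
    using True by (simp add: max_def algebra_simps)
  also have "\<dots> \<le> K / \<gamma> * (r powr \<gamma> * w powr \<beta>)"
    using assms by (intro mult_right_mono) (auto simp: field_simps)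
  finally show ?thesis
    using exp_ge_add_one_self[of "K * r * w powr \<beta> * max w \<delta> powr (\<theta> - \<beta>)"]
    by (smt (verit) exp_le_cancel_iff mult.assoc)
next
  case False
  have eq: "K * r * w powr \<beta> * max w \<delta> powr (\<theta> - \<beta>) = K * (r * w powr \<theta>)"
    using False by (simp add: max_def mult.assoc flip: powr_add)
  have "(K * (r * w powr \<theta>)) powr \<gamma> = K powr \<gamma> * (r powr \<gamma> * w powr \<beta>)"
    using assms by (simp add: powr_mult powr_powr)
  also have "\<dots> \<le> K * (r powr \<gamma> * w powr \<beta>)"
    using assms powr_mono[of \<gamma> 1 K] by (intro mult_right_mono) auto
  finally have "(K * (r * w powr \<theta>)) powr \<gamma> / \<gamma> \<le> K * (r powr \<gamma> * w powr \<beta>) / \<gamma>"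
    using assms by (intro divide_right_mono) auto
  moreover have "1 + K * (r * w powr \<theta>) \<le> exp ((K * (r * w powr \<theta>)) powr \<gamma> / \<gamma>)"
    using assms by (intro one_plus_le_exp_powr) auto
  ultimately show ?thesis
    unfolding eq by (smt (verit) exp_le_cancel_iff mult.assoc times_divide_eq_left)
qed

text \<open>
  The constant \<open>M\<close> does not depend on \<open>r\<close>, \<open>X\<close>, \<open>Y\<close> and \<open>n\<close>. In the relation for \<open>\<gamma>\<close>, the
  number \<open>(1 + \<sigma>) / 2\<close> is the exponent of \<open>w\<close> in the geometric mean of the two off-diagonal
  bounds \<open>w\<close> and \<open>w powr \<sigma>\<close>: no choice of weights can make both of them smaller than that.
\<close>

lemma coupled_growth_exp_powr:
  fixes g f w :: "nat \<Rightarrow> real" and \<beta> \<sigma> \<gamma> K :: real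
  assumes \<beta>: "0 < \<beta>" "\<beta> \<le> 1" "\<beta> \<le> \<sigma>" and \<gamma>: "\<gamma> * (1 + \<sigma>) = 2 * \<beta>" and K: "1 \<le> K"
    and w0: "\<And>n. w n \<ge> 0" and wS: "\<And>n. w (Suc n) \<le> w n"
    and sw: "summable (\<lambda>n. w n powr \<beta>)"
    and gw: "\<And>n. g n \<le> K * w n" and fw: "\<And>n. f n \<le> K * w n powr \<sigma>"
  obtains M where
    "\<And>r X Y n. r \<ge> 1 \<Longrightarrow> (\<And>n. X n \<ge> 0) \<Longrightarrow> (\<And>n. Y n \<ge> 0) \<Longrightarrow> X 0 \<le> 1 \<Longrightarrow> Y 0 \<le> 1
       \<Longrightarrow> (\<And>n. X (Suc n) \<le> X n + r * g n * Y n)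
       \<Longrightarrow> (\<And>n. Y (Suc n) \<le> Y n + r * f n * X n)
       \<Longrightarrow> X n \<le> exp (M * r powr \<gamma>) \<and> Y n \<le> exp (M * r powr \<gamma>)"
proof -
  define \<theta> where "\<theta> = (1 + \<sigma>) / 2"
  have \<sigma>0: "\<sigma> > 0" using \<beta> by simp
  have \<gamma>0: "\<gamma> > 0"
    using \<gamma> \<beta> \<sigma>0 by (smt (verit) zero_less_mult_pos2)
  have \<gamma>1: "\<gamma> \<le> 1"
  proof -
    have "\<gamma> * (1 + \<sigma>) \<le> 1 * (1 + \<sigma>)" using \<gamma> \<beta> by simp
    then show ?thesis using \<sigma>0 by simp
  qed
  have \<theta>: "\<theta> > 0" "\<theta> * \<gamma> = \<beta>"
    using \<gamma> \<sigma>0 by (auto simp: \<theta>_def field_simps)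
  define T where "T = max (w 0) 1"
  define H where "H = T powr (\<sigma> / 2) + T powr (1 / 2)"
  have H1: "H \<ge> 1"
    using ge_one_powr_ge_zero[of T "1/2"] by (simp add: H_def T_def add_increasing)
  define S where "S = (\<Sum>n. w n powr \<beta>)"
  define M where "M = H + K / \<gamma> * S + 1 / \<gamma>"
  show ?thesis
  proof (rule that)
    fix r :: real and X Y :: "nat \<Rightarrow> real" and n :: nat
    assume r: "r \<ge> 1" and X0: "\<And>n. X n \<ge> 0" and Y0: "\<And>n. Y n \<ge> 0" and X1: "X 0 \<le> 1" and Y1: "Y 0 \<le> 1"
      and XS: "\<And>n. X (Suc n) \<le> X n + r * g n * Y n"
      and YS: "\<And>n. Y (Suc n) \<le> Y n + r * f n * X n"
    define \<delta> where "\<delta> = r powr (- 1 / \<theta>)"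
    have \<delta>: "\<delta> > 0" "\<delta> \<le> 1"
      using r \<theta> powr_mono[of "- 1 / \<theta>" 0 r] by (auto simp: \<delta>_def)
    define W where "W n = max (w n) \<delta>" for n
    have W0: "W n > 0" and W\<delta>: "W n \<ge> \<delta>" and WS: "W (Suc n) \<le> W n" and wW: "w n \<le> W n" for n
      using \<delta> wS[of n] by (auto simp: W_def)
    have WT: "W 0 \<le> T" using \<delta> by (auto simp: W_def T_def)
    \<comment> \<open>With \<open>p / q = W powr (\<theta> - 1)\<close>, both entries \<open>r * g * p / q\<close> and \<open>r * f * q / p\<close>
      get the same bound \<open>h\<close>.\<close>
    define p where "p n = W n powr (\<sigma> / 2)" for n
    define q where "q n = W n powr (1 / 2)" for n
    define h where "h n = K * r * w n powr \<beta> * W n powr (\<theta> - \<beta>)" for n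
    have main: "p n * X n + q n * Y n \<le> (p 0 * X 0 + q 0 * Y 0) * (\<Prod>k<n. 1 + h k)"
    proof (rule weighted_coupled_growth[where X = X and Y = Y and r = r and g = g and f = f, OF X0 Y0 XS YS])
      fix n
      show "p n \<ge> 0" "q n \<ge> 0" by (auto simp: p_def q_def)
      show "p (Suc n) \<le> p n" "q (Suc n) \<le> q n"
        unfolding p_def q_def using \<sigma>0 W0[of "Suc n"] WS[of n] by (auto intro!: powr_mono2)
      show "h n \<ge> 0" using K r by (simp add: h_def)
      have "g n \<le> K * (w n powr \<beta> * W n powr (1 - \<beta>))"
        using gw[of n] powr_le_powr_mult_powr_diff[OF w0 wW, of \<beta> 1 n] \<beta>(2) w0[of n] K
        by (smt (verit) mult_left_mono powr_one)
      then have "r * g n * p n \<le> r * (K * (w n powr \<beta> * W n powr (1 - \<beta>))) * p n"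
        using r by (intro mult_right_mono mult_left_mono) (auto simp: p_def)
      also have "\<dots> = K * r * w n powr \<beta> * W n powr ((1 - \<beta>) + \<sigma> / 2)"
        by (simp add: p_def powr_add)
      also have "(1 - \<beta>) + \<sigma> / 2 = (\<theta> - \<beta>) + 1 / 2"
        by (simp add: \<theta>_def field_simps)
      finally show "r * g n * p n \<le> h n * q n"
        by (simp add: h_def q_def powr_add mult.assoc)
      have "f n \<le> K * (w n powr \<beta> * W n powr (\<sigma> - \<beta>))"
        using fw[of n] powr_le_powr_mult_powr_diff[OF w0 wW, of \<beta> \<sigma> n] \<beta>(3) K
        by (smt (verit) mult_left_mono)
      then have "r * f n * q n \<le> r * (K * (w n powr \<beta> * W n powr (\<sigma> - \<beta>))) * q n"
        using r by (intro mult_right_mono mult_left_mono) (auto simp: q_def)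
      also have "\<dots> = K * r * w n powr \<beta> * W n powr ((\<sigma> - \<beta>) + 1 / 2)"
        by (simp add: q_def powr_add)
      also have "(\<sigma> - \<beta>) + 1 / 2 = (\<theta> - \<beta>) + \<sigma> / 2"
        by (simp add: \<theta>_def field_simps)
      finally show "r * f n * q n \<le> h n * p n"
        by (simp add: h_def p_def powr_add mult.assoc)
    qed
    have "(\<Prod>k<n. 1 + h k) \<le> (\<Prod>k<n. exp (K / \<gamma> * r powr \<gamma> * w k powr \<beta>))"
    proof (intro prod_mono conjI)
      fix k
      show "0 \<le> 1 + h k" using K r by (simp add: h_def)
      show "1 + h k \<le> exp (K / \<gamma> * r powr \<gamma> * w k powr \<beta>)"
        unfolding h_def W_def \<delta>_def
        using truncated_weight_factor[OF w0 _ \<gamma>0 \<gamma>1 \<theta> K, of r k] r by simp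
    qed
    also have "\<dots> = exp (K / \<gamma> * r powr \<gamma> * (\<Sum>k<n. w k powr \<beta>))"
      by (simp add: exp_sum sum_distrib_left)
    also have "\<dots> \<le> exp (K / \<gamma> * r powr \<gamma> * S)"
    proof -
      have "(\<Sum>k<n. w k powr \<beta>) \<le> S"
        unfolding S_def by (intro sum_le_suminf sw) auto
      moreover have "0 \<le> K / \<gamma> * r powr \<gamma>" using K \<gamma>0 by simp
      ultimately show ?thesis
        unfolding exp_le_cancel_iff by (rule mult_left_mono)
    qed
    finally have prod_le: "(\<Prod>k<n. 1 + h k) \<le> exp (K / \<gamma> * r powr \<gamma> * S)" .
    have "p 0 * X 0 \<le> T powr (\<sigma> / 2) * 1"
      unfolding p_def using WT W0[of 0] X0[of 0] X1 \<sigma>0 by (intro mult_mono powr_mono2) simp_all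
    moreover have "q 0 * Y 0 \<le> T powr (1 / 2) * 1"
      unfolding q_def using WT W0[of 0] Y0[of 0] Y1 by (intro mult_mono powr_mono2) simp_all
    ultimately have init: "p 0 * X 0 + q 0 * Y 0 \<le> H" by (simp add: H_def)
    have total: "p n * X n + q n * Y n \<le> H * exp (K / \<gamma> * r powr \<gamma> * S)"
      using main init prod_le H1 K r
      by (smt (verit) mult_mono prod_nonneg h_def mult_nonneg_nonneg powr_ge_zero)
    have rg: "1 \<le> r powr \<gamma>" using r \<gamma>0 by (simp add: ge_one_powr_ge_zero)
    \<comment> \<open>A weight is at least \<open>\<delta> powr \<theta> = 1 / r\<close>, so removing it costs at most the factor \<open>r\<close>.\<close>
    have fin: "Z \<le> exp (M * r powr \<gamma>)"
      if Z: "Z \<ge> 0" "W n powr c * Z \<le> H * exp (K / \<gamma> * r powr \<gamma> * S)" and c: "0 \<le> c" "c \<le> \<theta>" for Z c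
    proof -
      have "\<delta> powr c * Z \<le> W n powr c * Z"
        using W\<delta>[of n] \<delta> Z c by (intro mult_right_mono powr_mono2) auto
      then have *: "\<delta> powr c * Z \<le> H * exp (K / \<gamma> * r powr \<gamma> * S)"
        using Z by simp
      have "1 / r = r powr (- 1)" using r by (simp add: powr_minus_divide)
      also have "\<dots> \<le> r powr ((- 1 / \<theta>) * c)"
        using r c \<theta> by (intro powr_mono) (auto simp: field_simps)
      also have "\<dots> = \<delta> powr c" by (simp add: \<delta>_def powr_powr)
      finally have "1 / r * Z \<le> \<delta> powr c * Z" using Z by (intro mult_right_mono)
      with * have "1 / r * Z \<le> H * exp (K / \<gamma> * r powr \<gamma> * S)" by linarith
      then have "Z \<le> H * exp (K / \<gamma> * r powr \<gamma> * S) * r"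
        using r by (simp add: field_simps)
      also have "\<dots> \<le> exp (H * r powr \<gamma>) * exp (K / \<gamma> * r powr \<gamma> * S) * exp (r powr \<gamma> / \<gamma>)"
      proof (intro mult_mono)
        have "H * 1 \<le> H * r powr \<gamma>" using H1 rg by (intro mult_left_mono) auto
        then show "H \<le> exp (H * r powr \<gamma>)"
          using exp_ge_add_one_self[of "H * r powr \<gamma>"] by linarith
        show "r \<le> exp (r powr \<gamma> / \<gamma>)"
          using one_plus_le_exp_powr[of r \<gamma>] r \<gamma>0 \<gamma>1 by simp
      qed (use r in auto)
      also have "\<dots> = exp (M * r powr \<gamma>)"
        by (simp add: M_def exp_add[symmetric] algebra_simps)
      finally show ?thesis .
    qed
    have "p n * X n \<ge> 0" "q n * Y n \<ge> 0" using X0 Y0 by (auto simp: p_def q_def)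
    with total have "p n * X n \<le> H * exp (K / \<gamma> * r powr \<gamma> * S)"
      "q n * Y n \<le> H * exp (K / \<gamma> * r powr \<gamma> * S)"
      by linarith+
    then show "X n \<le> exp (M * r powr \<gamma>) \<and> Y n \<le> exp (M * r powr \<gamma>)"
      unfolding p_def q_def using fin[OF X0] fin[OF Y0] \<sigma>0 by (auto simp: \<theta>_def)
  qed
qed

section \<open>Order of growth\<close>

text \<open>
  The lower bound \<open>1\<close> keeps \<open>ln (max_modulus f r)\<close> nonnegative, so that the outer
  logarithm is monotone there; at the value \<open>0\<close> it relies on the convention \<open>ln 0 = 0\<close>.
\<close>

lemma entire_order_le:
  assumes "\<gamma> > 0"
    and ev: "eventually (\<lambda>r. 1 \<le> max_modulus f r \<and> max_modulus f r \<le> exp (M * r powr \<gamma>)) at_top"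
  shows "entire_order f \<le> ereal \<gamma>"
proof -
  let ?M = "max M 1"
  have "eventually (\<lambda>r. ln (ln (max_modulus f r)) / ln r \<le> ln ?M / ln r + \<gamma>) at_top"
    using ev eventually_gt_at_top[of 1]
  proof eventually_elim
    case (elim r)
    let ?L = "ln (max_modulus f r)"
    have rg: "1 \<le> r powr \<gamma>" using elim assms by (simp add: ge_one_powr_ge_zero)
    have L0: "?L \<ge> 0" using elim by simp
    have "?L \<le> M * r powr \<gamma>" using elim ln_le_cancel_iff[of "max_modulus f r" "exp (M * r powr \<gamma>)"] by simp
    also have "\<dots> \<le> ?M * r powr \<gamma>" by (intro mult_right_mono) auto
    finally have L: "?L \<le> ?M * r powr \<gamma>" .
    have G: "ln (?M * r powr \<gamma>) = ln ?M + \<gamma> * ln r"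
      using elim by (subst ln_mult) (auto simp: ln_powr)
    have "1 \<le> ?M * r powr \<gamma>" using mult_mono[of 1 ?M 1 "r powr \<gamma>"] rg by simp
    then have "ln ?L \<le> ln (?M * r powr \<gamma>)"
      using L L0 by (cases "?L = 0") auto
    then have "ln ?L / ln r \<le> (ln ?M + \<gamma> * ln r) / ln r"
      unfolding G using elim by (intro divide_right_mono) auto
    then show ?case using elim by (simp add: add_divide_distrib)
  qed
  then have "entire_order f \<le> Limsup at_top (\<lambda>r. ereal (ln ?M / ln r + \<gamma>))"
    unfolding entire_order_def by (intro Limsup_mono) simp
  also have "\<dots> = ereal \<gamma>"
  proof (rule lim_imp_Limsup)
    have "((\<lambda>r. ln ?M / ln r + \<gamma>) \<longlongrightarrow> 0 + \<gamma>) at_top"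
      by (intro tendsto_intros real_tendsto_divide_at_top[OF tendsto_const] ln_at_top)
    then show "((\<lambda>r. ereal (ln ?M / ln r + \<gamma>)) \<longlongrightarrow> ereal \<gamma>) at_top"
      by simp
  qed simp
  finally show ?thesis .
qed

section \<open>The recurrence at a point in terms of its solutions at zero\<close>

lemma three_term_of_real:
  "three_term a b x y n (of_real t) = (of_real (three_term a b x y n t) :: 'a::real_normed_field)"
  by (induction a b x y n t rule: three_term.induct) simp_all

lemma orthoP_complex_0: "orthoP a b n (0::complex) = of_real (orthoP a b n 0)"
  using three_term_of_real[of a b 0 1 "Suc n" 0, where 'a = complex] by (simp add: orthoP_def)

lemma secondQ_complex_0: "secondQ a b n (0::complex) = of_real (secondQ a b n 0)"
  using three_term_of_real[of a b "-1" 0 "Suc n" 0, where 'a = complex] by (simp add: secondQ_def)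

lemma three_term_wronskian:
  fixes z :: "'a::real_normed_field"
  assumes b: "\<And>n. b n > 0"
  shows "three_term a b 0 1 (Suc n) z * three_term a b (- 1) 0 (Suc (Suc n)) z
       - three_term a b (- 1) 0 (Suc n) z * three_term a b 0 1 (Suc (Suc n)) z = 1 / of_real (b n)"
proof (induction n)
  case 0
  then show ?case by simp
next
  case (Suc n)
  have rec: "three_term a b x y (Suc (Suc (Suc n))) z
      = ((z - of_real (a (Suc n))) * three_term a b x y (Suc (Suc n)) z
          - of_real (b n) * three_term a b x y (Suc n) z) / of_real (b (Suc n))" for x y
    using three_term.simps(3)[of a b x y "Suc n" z] by (simp del: three_term.simps)
  have "three_term a b 0 1 (Suc (Suc n)) z * three_term a b (- 1) 0 (Suc (Suc (Suc n))) z
       - three_term a b (- 1) 0 (Suc (Suc n)) z * three_term a b 0 1 (Suc (Suc (Suc n))) z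
     = of_real (b n) * (three_term a b 0 1 (Suc n) z * three_term a b (- 1) 0 (Suc (Suc n)) z
       - three_term a b (- 1) 0 (Suc n) z * three_term a b 0 1 (Suc (Suc n)) z) / of_real (b (Suc n))"
    unfolding rec by (simp add: add_divide_distrib diff_divide_distrib algebra_simps del: three_term.simps)
  then show ?case
    unfolding Suc using b[of n] by simp
qed

text \<open>
  As \<open>n\<close> tends to infinity, these become \<open>D\<close> and \<open>B\<close> for \<open>(x, y) = (0, 1)\<close>, and \<open>C\<close> and \<open>A\<close> for
  \<open>(x, y) = (- 1, 0)\<close>. Each is named after the polynomials that weight its sum; in the
  representation of the solution it multiplies the other ones.
\<close>

definition P_coefficient where
  "P_coefficient a b x y n z =
     - of_real x + z * (\<Sum>k<n. orthoP a b k 0 * three_term a b x y (Suc k) z)"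

definition Q_coefficient where
  "Q_coefficient a b x y n z =
     - of_real y + z * (\<Sum>k<n. secondQ a b k 0 * three_term a b x y (Suc k) z)"

text \<open>
  The same pair of coefficients represents the solution at two consecutive indices, so the
  recurrence at \<open>0\<close> carries the representation one index further, up to the missing term
  \<open>z R\<^sub>n / b\<^sub>n\<close>, where \<open>R\<^sub>n\<close> is the solution. Updating the coefficients supplies this term through the Wronskian, and it leaves
  the value at the lower index unchanged, because there the Wronskian is replaced by
  \<open>P\<^sub>n Q\<^sub>n - Q\<^sub>n P\<^sub>n = 0\<close>.
\<close>

lemma variation_of_constants:
  fixes z :: "'a::real_normed_field"
  assumes b: "\<And>n. b n > 0"
  shows "three_term a b x y n z =
           P_coefficient a b x y n z * three_term a b (- 1) 0 n 0
             - Q_coefficient a b x y n z * three_term a b 0 1 n 0 \<and>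
         three_term a b x y (Suc n) z =
           P_coefficient a b x y n z * three_term a b (- 1) 0 (Suc n) 0
             - Q_coefficient a b x y n z * three_term a b 0 1 (Suc n) 0"
proof (induction n)
  case 0
  then show ?case by (simp add: P_coefficient_def Q_coefficient_def)
next
  case (Suc n)
  let ?E = "P_coefficient a b x y n z" and ?F = "Q_coefficient a b x y n z"
  let ?P = "\<lambda>n. three_term a b 0 1 n (0::'a)" and ?Q = "\<lambda>n. three_term a b (- 1) 0 n (0::'a)"
  let ?R = "\<lambda>n. three_term a b x y n z"
  have E: "P_coefficient a b x y (Suc n) z = ?E + z * ?P (Suc n) * ?R (Suc n)"
    by (simp add: P_coefficient_def orthoP_def algebra_simps)
  have F: "Q_coefficient a b x y (Suc n) z = ?F + z * ?Q (Suc n) * ?R (Suc n)"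
    by (simp add: Q_coefficient_def secondQ_def algebra_simps)
  have bn: "of_real (b n) \<noteq> (0::'a)" using b[of n] by simp
  define c where "c = (of_real (if n = 0 then 1 else b (n - 1)) :: 'a)"
  have rec: "?R (Suc (Suc n)) = ((z - of_real (a n)) * ?R (Suc n) - c * ?R n) / of_real (b n)"
    "?P (Suc (Suc n)) = ((0 - of_real (a n)) * ?P (Suc n) - c * ?P n) / of_real (b n)"
    "?Q (Suc (Suc n)) = ((0 - of_real (a n)) * ?Q (Suc n) - c * ?Q n) / of_real (b n)"
    unfolding c_def by (rule three_term.simps(3))+
  have 1: "?R (Suc n) = P_coefficient a b x y (Suc n) z * ?Q (Suc n)
             - Q_coefficient a b x y (Suc n) z * ?P (Suc n)"
    unfolding E F using Suc by (simp add: algebra_simps)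
  have old: "?E * ?Q (Suc (Suc n)) - ?F * ?P (Suc (Suc n))
      = ((0 - of_real (a n)) * (?E * ?Q (Suc n) - ?F * ?P (Suc n)) - c * (?E * ?Q n - ?F * ?P n)) / of_real (b n)"
    unfolding rec by (simp add: add_divide_distrib diff_divide_distrib algebra_simps del: three_term.simps)
  have "P_coefficient a b x y (Suc n) z * ?Q (Suc (Suc n)) - Q_coefficient a b x y (Suc n) z * ?P (Suc (Suc n))
      = (?E * ?Q (Suc (Suc n)) - ?F * ?P (Suc (Suc n)))
        + z * ?R (Suc n) * (?P (Suc n) * ?Q (Suc (Suc n)) - ?Q (Suc n) * ?P (Suc (Suc n)))"
    unfolding E F by (simp only: algebra_simps)
  also have "\<dots> = ((0 - of_real (a n)) * ?R (Suc n) - c * ?R n) / of_real (b n)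
        + z * ?R (Suc n) * (1 / of_real (b n))"
    unfolding three_term_wronskian[OF b] old using Suc by simp
  also have "\<dots> = ?R (Suc (Suc n))"
    unfolding rec by (simp add: add_divide_distrib[symmetric] algebra_simps)
  finally show ?case using 1 by simp
qed

lemma symmetric_zero_values:
  assumes "\<And>n. a n = 0"
  shows "orthoP a b (2 * n + 1) (0::real) = 0 \<and> secondQ a b (2 * n) (0::real) = 0"
  using assms by (induction n) (auto simp: orthoP_def secondQ_def)

context
  fixes a b :: "nat \<Rightarrow> real"
  assumes b: "\<And>n. b n > 0" and a: "\<And>n. a n = 0"
begin

lemma symmetric_product_zero: "orthoP a b n (0::real) * secondQ a b n 0 = 0"
  using symmetric_zero_values[OF a, where b = b]
  by (cases "even n") (auto elim!: evenE oddE)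

text \<open>
  Only one of \<open>P\<^sub>n(0)\<close> and \<open>Q\<^sub>n(0)\<close> is nonzero, so multiplying the solution by either of them
  singles out one coefficient.
\<close>

lemma symmetric_solution:
  fixes z :: complex
  shows "orthoP a b n 0 * three_term a b x y (Suc n) z
           = - of_real ((orthoP a b n 0)\<^sup>2) * Q_coefficient a b x y n z"
    and "secondQ a b n 0 * three_term a b x y (Suc n) z
           = of_real ((secondQ a b n 0)\<^sup>2) * P_coefficient a b x y n z"
proof -
  have eq: "three_term a b x y (Suc n) z = P_coefficient a b x y n z * of_real (secondQ a b n 0)
             - Q_coefficient a b x y n z * of_real (orthoP a b n 0)"
    using variation_of_constants[OF b, where x = x and y = y and z = z and n = n and a = a]
    by (simp add: orthoP_def secondQ_def flip: three_term_of_real del: three_term.simps)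
  have 0: "of_real (orthoP a b n 0) * of_real (secondQ a b n 0) = (0::complex)"
    by (metis symmetric_product_zero of_real_mult of_real_0)
  show "orthoP a b n 0 * three_term a b x y (Suc n) z
           = - of_real ((orthoP a b n 0)\<^sup>2) * Q_coefficient a b x y n z"
    unfolding eq orthoP_complex_0 using 0 by (auto simp: algebra_simps power2_eq_square)
  show "secondQ a b n 0 * three_term a b x y (Suc n) z
           = of_real ((secondQ a b n 0)\<^sup>2) * P_coefficient a b x y n z"
    unfolding eq secondQ_complex_0 using 0 by (auto simp: algebra_simps power2_eq_square)
qed

lemma symmetric_coefficient_Suc:
  fixes z :: complex
  shows "P_coefficient a b x y (Suc n) z
           = P_coefficient a b x y n z - z * of_real ((orthoP a b n 0)\<^sup>2) * Q_coefficient a b x y n z"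
    and "Q_coefficient a b x y (Suc n) z
           = Q_coefficient a b x y n z + z * of_real ((secondQ a b n 0)\<^sup>2) * P_coefficient a b x y n z"
proof -
  show "P_coefficient a b x y (Suc n) z
           = P_coefficient a b x y n z - z * of_real ((orthoP a b n 0)\<^sup>2) * Q_coefficient a b x y n z"
    using symmetric_solution(1)[of n x y z]
    by (simp add: P_coefficient_def algebra_simps del: three_term.simps of_real_power)
  show "Q_coefficient a b x y (Suc n) z
           = Q_coefficient a b x y n z + z * of_real ((secondQ a b n 0)\<^sup>2) * P_coefficient a b x y n z"
    using symmetric_solution(2)[of n x y z]
    by (simp add: Q_coefficient_def algebra_simps del: three_term.simps of_real_power)
qed

text \<open>
  For \<open>z = \<i> t\<close> the coefficients stay on the rays \<open>\<omega> \<real>\<^sub>\<ge>\<^sub>0\<close> and \<open>\<i> \<omega> \<real>\<^sub>\<ge>\<^sub>0\<close> with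
  a fixed \<open>\<omega>\<close>, because both \<open>- z * \<i>\<close> and \<open>z / \<i>\<close> equal \<open>t\<close>. Hence the triangle inequality
  is an equality in each step, and the norms increase with \<open>n\<close>.
\<close>

lemma imaginary_axis_norms:
  fixes x y t :: real
  assumes t: "t \<ge> 0" and xy: "x = 0 \<or> y = 0"
  shows "norm (P_coefficient a b x y (Suc n) (\<i> * of_real t))
           = norm (P_coefficient a b x y n (\<i> * of_real t))
             + t * (orthoP a b n 0)\<^sup>2 * norm (Q_coefficient a b x y n (\<i> * of_real t))"
      (is ?thesis1)
    and "norm (Q_coefficient a b x y (Suc n) (\<i> * of_real t))
           = norm (Q_coefficient a b x y n (\<i> * of_real t))
             + t * (secondQ a b n 0)\<^sup>2 * norm (P_coefficient a b x y n (\<i> * of_real t))"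
      (is ?thesis2)
proof -
  define z where "z = \<i> * complex_of_real t"
  let ?E = "\<lambda>n. P_coefficient a b x y n z" and ?F = "\<lambda>n. Q_coefficient a b x y n z"
  define \<omega> where "\<omega> = (if y = 0 then - of_real (sgn x) else \<i> * of_real (sgn y) :: complex)"
  have dir: "\<exists>c d. c \<ge> 0 \<and> d \<ge> 0 \<and> ?E n = \<omega> * of_real c \<and> ?F n = \<i> * \<omega> * of_real d" for n
  proof (induction n)
    case 0
    have "?E 0 = \<omega> * of_real \<bar>x\<bar>" "?F 0 = \<i> * \<omega> * of_real \<bar>y\<bar>"
      using xy by (auto simp: P_coefficient_def Q_coefficient_def \<omega>_def sgn_mult_abs
          simp flip: of_real_mult mult.assoc)
    then show ?case by (metis abs_ge_zero)
  next
    case (Suc n)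
    then obtain c d where "c \<ge> 0" "d \<ge> 0" "?E n = \<omega> * of_real c" "?F n = \<i> * \<omega> * of_real d"
      by blast
    then have "?E (Suc n) = \<omega> * of_real (c + t * (orthoP a b n 0)\<^sup>2 * d)"
      "?F (Suc n) = \<i> * \<omega> * of_real (d + t * (secondQ a b n 0)\<^sup>2 * c)"
      unfolding symmetric_coefficient_Suc by (simp_all add: z_def algebra_simps)
    moreover have "c + t * (orthoP a b n 0)\<^sup>2 * d \<ge> 0" "d + t * (secondQ a b n 0)\<^sup>2 * c \<ge> 0"
      using t \<open>c \<ge> 0\<close> \<open>d \<ge> 0\<close> by auto
    ultimately show ?case by blast
  qed
  obtain c d where cd: "c \<ge> 0" "d \<ge> 0" "?E n = \<omega> * of_real c" "?F n = \<i> * \<omega> * of_real d"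
    using dir by blast
  have "?E (Suc n) = \<omega> * of_real (c + t * (orthoP a b n 0)\<^sup>2 * d)"
    "?F (Suc n) = \<i> * \<omega> * of_real (d + t * (secondQ a b n 0)\<^sup>2 * c)"
    unfolding symmetric_coefficient_Suc using cd by (simp_all add: z_def algebra_simps)
  moreover have "c + t * (orthoP a b n 0)\<^sup>2 * d \<ge> 0" "d + t * (secondQ a b n 0)\<^sup>2 * c \<ge> 0"
    using t cd by auto
  ultimately show ?thesis1 ?thesis2
    using cd unfolding z_def[symmetric]
    by (simp_all only: norm_mult norm_of_real norm_ii abs_of_nonneg) (simp_all add: algebra_simps)
qed

text \<open>
  With \<open>(x, y) = (0, 1)\<close> this concerns \<open>D\<close> and \<open>B\<close>, with \<open>(x, y) = (- 1, 0)\<close> it concerns \<open>C\<close>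
  and \<open>A\<close>. The uniform bound on the coefficients also makes the defining series converge
  absolutely, as their terms are those coefficients times summable squares.
\<close>

lemma symmetric_order_le:
  fixes x y :: real
  assumes \<beta>: "0 < \<beta>" "\<beta> \<le> 1" "\<beta> \<le> \<sigma>" and \<gamma>: "\<gamma> * (1 + \<sigma>) = 2 * \<beta>" and K: "1 \<le> K"
    and w0: "\<And>n. w n \<ge> 0" and wS: "\<And>n. w (Suc n) \<le> w n"
    and sw: "summable (\<lambda>n. w n powr \<beta>)"
    and gw: "\<And>n. (orthoP a b n 0)\<^sup>2 \<le> K * w n"
    and fw: "\<And>n. (secondQ a b n 0)\<^sup>2 \<le> K * w n powr \<sigma>"
    and xy: "x = 0 \<and> \<bar>y\<bar> = 1 \<or> \<bar>x\<bar> = 1 \<and> y = 0"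
  shows "entire_order (\<lambda>z. - of_real x + z * (\<Sum>k. orthoP a b k 0 * three_term a b x y (Suc k) z)) \<le> ereal \<gamma>"
      (is "entire_order ?E \<le> _")
    and "entire_order (\<lambda>z. - of_real y + z * (\<Sum>k. secondQ a b k 0 * three_term a b x y (Suc k) z)) \<le> ereal \<gamma>"
      (is "entire_order ?F \<le> _")
proof -
  let ?g = "\<lambda>n. (orthoP a b n (0::real))\<^sup>2" and ?f = "\<lambda>n. (secondQ a b n (0::real))\<^sup>2"
  let ?En = "P_coefficient a b x y :: nat \<Rightarrow> complex \<Rightarrow> complex" and ?Fn = "Q_coefficient a b x y :: nat \<Rightarrow> complex \<Rightarrow> complex"
  have \<gamma>0: "\<gamma> > 0" using \<gamma> \<beta> by (smt (verit) zero_less_mult_pos2)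
  obtain M where bound:
    "\<And>r X Y n. r \<ge> 1 \<Longrightarrow> (\<And>n. X n \<ge> 0) \<Longrightarrow> (\<And>n. Y n \<ge> 0) \<Longrightarrow> X 0 \<le> 1 \<Longrightarrow> Y 0 \<le> 1
       \<Longrightarrow> (\<And>n. X (Suc n) \<le> X n + r * ?g n * Y n)
       \<Longrightarrow> (\<And>n. Y (Suc n) \<le> Y n + r * ?f n * X n)
       \<Longrightarrow> X n \<le> exp (M * r powr \<gamma>) \<and> Y n \<le> exp (M * r powr \<gamma>)"
    using coupled_growth_exp_powr[OF \<beta> \<gamma> K w0 wS sw gw fw] by blast
  have le: "norm (?En n z) \<le> exp (M * norm z powr \<gamma>) \<and> norm (?Fn n z) \<le> exp (M * norm z powr \<gamma>)"
    if z: "norm z \<ge> 1" for n z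
  proof (rule bound[OF z])
    show "norm (?En 0 z) \<le> 1" "norm (?Fn 0 z) \<le> 1"
      using xy by (auto simp: P_coefficient_def Q_coefficient_def)
    fix n
    show "norm (?En (Suc n) z) \<le> norm (?En n z) + norm z * ?g n * norm (?Fn n z)"
      unfolding symmetric_coefficient_Suc
      by (rule order_trans[OF norm_triangle_ineq4]) (simp add: norm_mult norm_power)
    show "norm (?Fn (Suc n) z) \<le> norm (?Fn n z) + norm z * ?f n * norm (?En n z)"
      unfolding symmetric_coefficient_Suc
      by (rule order_trans[OF norm_triangle_ineq]) (simp add: norm_mult norm_power)
  qed auto
  have w_le: "w n \<le> w 0" for n
    by (rule lift_Suc_antimono_le[of w]) (use wS in auto)
  have sg: "summable ?g"
  proof (rule summable_comparison_test')
    show "summable (\<lambda>n. K * (w n powr \<beta> * w 0 powr (1 - \<beta>)))"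
      by (intro summable_mult summable_mult2 sw)
    fix n show "norm (?g n) \<le> K * (w n powr \<beta> * w 0 powr (1 - \<beta>))"
      using gw[of n] powr_le_powr_mult_powr_diff[OF w0 w_le, of \<beta> 1 n] \<beta>(2) w0[of n] K
      by (smt (verit) mult_left_mono powr_one real_norm_def zero_le_power2)
  qed
  have sf: "summable ?f"
  proof (rule summable_comparison_test')
    show "summable (\<lambda>n. K * (w n powr \<beta> * w 0 powr (\<sigma> - \<beta>)))"
      by (intro summable_mult summable_mult2 sw)
    fix n show "norm (?f n) \<le> K * (w n powr \<beta> * w 0 powr (\<sigma> - \<beta>))"
      using fw[of n] powr_le_powr_mult_powr_diff[OF w0 w_le, of \<beta> \<sigma> n] \<beta>(3) K
      by (smt (verit) mult_left_mono real_norm_def zero_le_power2)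
  qed
  have limE: "(\<lambda>n. ?En n z) \<longlonglongrightarrow> ?E z" and limF: "(\<lambda>n. ?Fn n z) \<longlonglongrightarrow> ?F z"
    if z: "norm z \<ge> 1" for z
  proof -
    let ?C = "exp (M * norm z powr \<gamma>)"
    have "summable (\<lambda>k. orthoP a b k 0 * three_term a b x y (Suc k) z)"
    proof (rule summable_comparison_test')
      show "summable (\<lambda>k. ?g k * ?C)" by (intro summable_mult2 sg)
      fix k show "norm (orthoP a b k 0 * three_term a b x y (Suc k) z) \<le> ?g k * ?C"
        unfolding symmetric_solution using le[OF z, of k]
        by (simp add: norm_mult norm_power mult_left_mono)
    qed
    then show "(\<lambda>n. ?En n z) \<longlonglongrightarrow> ?E z"
      unfolding P_coefficient_def by (intro tendsto_intros summable_LIMSEQ)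
    have "summable (\<lambda>k. secondQ a b k 0 * three_term a b x y (Suc k) z)"
    proof (rule summable_comparison_test')
      show "summable (\<lambda>k. ?f k * ?C)" by (intro summable_mult2 sf)
      fix k show "norm (secondQ a b k 0 * three_term a b x y (Suc k) z) \<le> ?f k * ?C"
        unfolding symmetric_solution using le[OF z, of k]
        by (simp add: norm_mult norm_power mult_left_mono)
    qed
    then show "(\<lambda>n. ?Fn n z) \<longlonglongrightarrow> ?F z"
      unfolding Q_coefficient_def by (intro tendsto_intros summable_LIMSEQ)
  qed
  \<comment> \<open>Only one of the two initial coefficients is nonzero. On the imaginary axis the first two
    steps spread it to the other one, with the factor \<open>t * P\<^sub>0(0)\<^sup>2 = t\<close> or
    \<open>t * Q\<^sub>1(0)\<^sup>2 = t / (b 0)\<^sup>2\<close>, and both factors are at least \<open>1\<close> for large \<open>t\<close>.\<close>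
  have g0: "?g 0 = 1" by (simp add: orthoP_def)
  have f1: "?f 1 = 1 / (b 0)\<^sup>2" by (simp add: secondQ_def power_divide)
  have lower: "1 \<le> norm (?E (\<i> * of_real t)) \<and> 1 \<le> norm (?F (\<i> * of_real t))"
    if t: "t \<ge> 1" "t \<ge> (b 0)\<^sup>2" for t
  proof -
    let ?z = "\<i> * complex_of_real t"
    have nz: "norm ?z \<ge> 1" using t by (simp add: norm_mult)
    have t0: "t \<ge> 0" using t by simp
    have xy0: "x = 0 \<or> y = 0" using xy by auto
    note im = imaginary_axis_norms[OF t0 xy0]
    have incE: "incseq (\<lambda>n. norm (?En n ?z))" and incF: "incseq (\<lambda>n. norm (?Fn n ?z))"
      using t0 by (auto intro!: incseq_SucI simp: im)
    have E_ge: "norm (?En n ?z) \<le> norm (?E ?z)" and F_ge: "norm (?Fn n ?z) \<le> norm (?F ?z)" for n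
      by (rule incseq_le[OF incE tendsto_norm[OF limE[OF nz]]], rule incseq_le[OF incF tendsto_norm[OF limF[OF nz]]])
    have E1: "norm (?En 1 ?z) = \<bar>x\<bar> + t * \<bar>y\<bar>"
      unfolding One_nat_def im g0 by (simp add: P_coefficient_def Q_coefficient_def)
    have F1: "norm (?Fn 1 ?z) \<ge> \<bar>y\<bar>"
      using incseqD[OF incF, of 0 1] by (simp add: Q_coefficient_def)
    have "norm (?Fn (Suc 1) ?z) = norm (?Fn 1 ?z) + t / (b 0)\<^sup>2 * (\<bar>x\<bar> + t * \<bar>y\<bar>)"
      unfolding im E1 f1 by simp
    moreover have "1 * \<bar>x\<bar> \<le> t / (b 0)\<^sup>2 * (\<bar>x\<bar> + t * \<bar>y\<bar>)"
      using t t0 b[of 0] by (intro mult_mono) auto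
    moreover have "1 * \<bar>y\<bar> \<le> t * \<bar>y\<bar>"
      using t by (intro mult_right_mono) auto
    moreover have "\<bar>x\<bar> + \<bar>y\<bar> = 1" using xy by auto
    ultimately have "norm (?Fn (Suc 1) ?z) \<ge> 1" "norm (?En 1 ?z) \<ge> 1"
      using F1 E1 by linarith+
    then show ?thesis using E_ge F_ge by (meson order_trans)
  qed
  have upper: "norm (?E z) \<le> exp (M * norm z powr \<gamma>) \<and> norm (?F z) \<le> exp (M * norm z powr \<gamma>)"
    if z: "norm z \<ge> 1" for z
    using le[OF z]
    by (intro conjI Lim_bounded[OF tendsto_norm[OF limE[OF z]]]
          Lim_bounded[OF tendsto_norm[OF limF[OF z]]]) blast+
  have order: "entire_order G \<le> ereal \<gamma>"
    if up: "\<And>z. norm z \<ge> 1 \<Longrightarrow> norm (G z) \<le> exp (M * norm z powr \<gamma>)"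
      and low: "\<And>t. t \<ge> 1 \<Longrightarrow> t \<ge> (b 0)\<^sup>2 \<Longrightarrow> 1 \<le> norm (G (\<i> * of_real t))" for G :: "complex \<Rightarrow> complex"
  proof (rule entire_order_le[OF \<gamma>0])
    show "eventually (\<lambda>r. 1 \<le> max_modulus G r \<and> max_modulus G r \<le> exp (M * r powr \<gamma>)) at_top"
      using eventually_ge_at_top[of 1] eventually_ge_at_top[of "(b 0)\<^sup>2"]
    proof eventually_elim
      case (elim r)
      have mem: "\<i> * complex_of_real r \<in> sphere 0 r" using elim by (simp add: norm_mult)
      have on: "norm (G z) \<le> exp (M * r powr \<gamma>)" if "z \<in> sphere 0 r" for z
        using up[of z] that elim by simp
      have "1 \<le> norm (G (\<i> * complex_of_real r))" using low elim by simp
      also have "\<dots> \<le> max_modulus G r"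
        unfolding max_modulus_def using on by (intro cSUP_upper[OF mem] bdd_aboveI2)
      finally show ?case
        unfolding max_modulus_def using mem on by (auto intro!: cSUP_least)
    qed
  qed
  show "entire_order ?E \<le> ereal \<gamma>" by (rule order) (use upper lower in blast)+
  show "entire_order ?F \<le> ereal \<gamma>" by (rule order) (use upper lower in blast)+
qed

end

section \<open>The order of the moment problem\<close>

lemma summable_Suc_div_2:
  fixes x :: "nat \<Rightarrow> real"
  assumes "summable x"
  shows "summable (\<lambda>n. x (Suc n div 2))"
proof -
  have "summable (\<lambda>n. x (Suc n))" using assms by (simp add: summable_Suc_iff)
  from sums_if[OF summable_sums[OF this] summable_sums[OF assms]]
  have "summable (\<lambda>n. if even n then x (n div 2) else x (Suc ((n - 1) div 2)))"
    by (rule sums_summable)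
  moreover have "(\<lambda>n. if even n then x (n div 2) else x (Suc ((n - 1) div 2))) = (\<lambda>n. x (Suc n div 2))"
    by (auto simp: fun_eq_iff elim!: oddE)
  ultimately show ?thesis by simp
qed

lemma almost_decreasing_majorant:
  fixes v :: "nat \<Rightarrow> real"
  assumes v: "\<And>i j. i \<le> j \<Longrightarrow> v j \<le> D * v i" and "D \<ge> 0"
  obtains w where "\<And>n. v n \<le> w n" "\<And>n. w n \<le> D * v n" "\<And>n. w (Suc n) \<le> w n"
proof
  let ?w = "\<lambda>n. D * Min (v ` {..n})"
  fix n
  have "Min (v ` {..n}) \<in> v ` {..n}" by (rule Min_in) auto
  then obtain i where "i \<le> n" "Min (v ` {..n}) = v i" by (metis atMost_iff imageE)
  then show "v n \<le> ?w n" using v by simp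
  show "?w n \<le> D * v n" "?w (Suc n) \<le> ?w n"
    using \<open>D \<ge> 0\<close> by (auto intro!: mult_left_mono Min_antimono)
qed

theorem theorem1p2:
  fixes s a b u v :: "nat \<Rightarrow> real" and \<alpha> \<beta> \<gamma> C D :: real
  assumes "jacobi_parameters s a b"
    and "indeterminate s"
    and "\<And>n. a n = 0"
    and "\<And>n. n \<ge> 1 \<Longrightarrow> v n = (orthoP a b (2 * n) 0)\<^sup>2"
    and "\<And>n. n \<ge> 1 \<Longrightarrow> u n = (secondQ a b (2 * n - 1) 0)\<^sup>2"
    and "0 < \<alpha>" "\<alpha> \<le> 1" "0 < \<beta>" "\<beta> \<le> 1"
    and "in_ell \<alpha> (\<lambda>n. u (Suc n))"
    and "in_ell \<beta> (\<lambda>n. v (Suc n))"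
    and "C > 0" "D > 0"
    and "\<And>n. n \<ge> 1 \<Longrightarrow> u n \<le> C * v n powr (\<beta> / \<alpha>)"
    and "\<And>i j. 1 \<le> i \<Longrightarrow> i \<le> j \<Longrightarrow> v j \<le> D * v i"
    and "1 / \<gamma> = (1 / 2) * (1 / \<alpha> + 1 / \<beta>)"
  shows "entire_order (nevanlinna_A a b) \<le> ereal \<gamma>
       \<and> entire_order (nevanlinna_B a b) \<le> ereal \<gamma>
       \<and> entire_order (nevanlinna_C a b) \<le> ereal \<gamma>
       \<and> entire_order (nevanlinna_D a b) \<le> ereal \<gamma>"
proof -
  have b: "\<And>n. b n > 0" using assms(1) by (simp add: jacobi_parameters_def)
  note a = assms(3)
  let ?p = "\<lambda>n. (orthoP a b (2 * n) (0::real))\<^sup>2"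
  define \<sigma> where "\<sigma> = \<beta> / \<alpha>"
  have \<sigma>: "\<beta> \<le> \<sigma>" using assms(6-9) by (simp add: \<sigma>_def field_simps mult_left_le)
  have "\<gamma> \<noteq> 0" using assms(6,8,16) by (auto simp: add_nonneg_eq_0_iff)
  have \<gamma>: "\<gamma> * (1 + \<sigma>) = 2 * \<beta>"
    using assms(6,8,16) \<open>\<gamma> \<noteq> 0\<close> by (simp add: \<sigma>_def field_simps)
  \<comment> \<open>The recurrence starts with \<open>P\<^sub>0(0)\<^sup>2 = 1\<close>, whereas (iii) starts at index \<open>1\<close>; enlarging
    the constant covers the index \<open>0\<close>.\<close>
  define E where "E = max (max 1 D) (D * ?p 1)"
  have E: "E \<ge> 1" "E \<ge> D" "E \<ge> D * ?p 1" by (auto simp: E_def)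
  have p_mono: "?p j \<le> E * ?p i" if "i \<le> j" for i j
  proof (cases "i = 0")
    case i: False
    have "?p j \<le> D * ?p i" using assms(15)[of i j] assms(4)[of i] assms(4)[of j] i that by simp
    also have "\<dots> \<le> E * ?p i" using E by (intro mult_right_mono) auto
    finally show ?thesis .
  next
    case i: True
    have [simp]: "orthoP a b 0 (0::real) = 1" by (simp add: orthoP_def)
    show ?thesis
    proof (cases "j = 0")
      case False
      then have "?p j \<le> D * ?p 1" using assms(15)[of 1 j] assms(4)[of j] assms(4)[of 1] by simp
      then show ?thesis using E i by simp
    qed (use E i in simp)
  qed
  \<comment> \<open>The squares \<open>v\<^sub>m\<close> and \<open>u\<^sub>m\<close> sit at the indices \<open>2 m\<close> and \<open>2 m - 1\<close> of the recurrence; both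
    \<open>n\<close> have \<open>Suc n div 2 = m\<close>.\<close>
  define h where "h n = ?p (Suc n div 2)" for n
  obtain w where hw: "\<And>n. h n \<le> w n" and wh: "\<And>n. w n \<le> E * h n" and wS: "\<And>n. w (Suc n) \<le> w n"
  proof (rule almost_decreasing_majorant[of h E])
    show "h j \<le> E * h i" if "i \<le> j" for i j
      unfolding h_def using that by (intro p_mono div_le_mono) auto
  qed (use E in auto)
  have w0: "w n \<ge> 0" for n using hw[of n] by (smt (verit) h_def zero_le_power2)
  have "summable (\<lambda>n. ?p (Suc n) powr \<beta>)"
    using assms(11) assms(4) by (simp add: in_ell_def)
  then have "summable (\<lambda>n. ?p n powr \<beta>)"
    by (subst (asm) summable_Suc_iff)
  then have sh: "summable (\<lambda>n. h n powr \<beta>)"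
    unfolding h_def by (rule summable_Suc_div_2)
  have sw: "summable (\<lambda>n. w n powr \<beta>)"
  proof (rule summable_comparison_test')
    show "summable (\<lambda>n. E powr \<beta> * h n powr \<beta>)" by (intro summable_mult sh)
    fix n show "norm (w n powr \<beta>) \<le> E powr \<beta> * h n powr \<beta>"
      using wh[of n] w0[of n] assms(8) E powr_mono2[of \<beta> "w n" "E * h n"]
      by (simp add: powr_mult h_def)
  qed
  define K where "K = max 1 C"
  have K: "K \<ge> 1" "K \<ge> C" by (auto simp: K_def)
  note zero = symmetric_zero_values[OF a, where b = b]
  have gw: "(orthoP a b n 0)\<^sup>2 \<le> K * w n" for n
  proof -
    have "(orthoP a b n 0)\<^sup>2 \<le> w n"
      using hw[of n] w0[of n] zero by (cases "even n") (auto elim!: evenE oddE simp: h_def)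
    also have "\<dots> \<le> K * w n" using K w0[of n] mult_right_mono[of 1 K "w n"] by simp
    finally show ?thesis .
  qed
  have fw: "(secondQ a b n 0)\<^sup>2 \<le> K * w n powr \<sigma>" for n
  proof (cases "even n")
    case True
    then show ?thesis using zero K by (auto elim!: evenE)
  next
    case False
    then obtain m where m: "n = 2 * m + 1" by (auto elim!: oddE)
    have "(secondQ a b n 0)\<^sup>2 \<le> C * h n powr \<sigma>"
      using assms(14)[of "Suc m"] assms(4)[of "Suc m"] assms(5)[of "Suc m"]
      by (simp add: m h_def \<sigma>_def)
    also have "\<dots> \<le> K * w n powr \<sigma>"
      using K hw[of n] assms(8) \<sigma> by (intro mult_mono powr_mono2) (auto simp: h_def)
    finally show ?thesis .
  qed
  note order = symmetric_order_le[OF b a assms(8,9) \<sigma> \<gamma> K(1) w0 wS sw gw fw]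
  show ?thesis
    using order[of 0 1] order[of "- 1" 0]
    unfolding nevanlinna_A_def[abs_def] nevanlinna_B_def[abs_def]
      nevanlinna_C_def[abs_def] nevanlinna_D_def[abs_def]
    by (simp add: orthoP_def[of a b _ "_ :: complex"] secondQ_def[of a b _ "_ :: complex"] del: three_term.simps)
qed

end
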